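(* (Pass-allowed Stops of Disjunctive Sums) For all $G,H\in\mathbb{GS}$, $$\underline{Ls}(G)+\underline{Rs}(H)\le\underline{Ls}(G+H)\le\underline{Ls}(G)+\underline{Ls}(H),$$ and symmetrically $$\overline{Rs}(G)+\overline{Rs}(H)\le\overline{Rs}(G+H)\le\overline{Rs}(G)+\overline{Ls}(H).$$
   Context: A scoring game is written $G=\langle G^{\mathcal L}\mid G^{\mathcal R}\rangle$, where each of $G^{\mathcal L}$ (Left options) and $G^{\mathcal R}$ (Right options) is either a finite nonempty set of scoring games or an atom $\emptyset^{s}$, $s\in\mathbb R$ (the player to move on that side cannot move and the game ends with score $s$); game trees are finite. An atom occurring in $G$ is an atom of $G$ or of any follower of $G$. $G$ is guaranteed if for every follower $K$ of $G$: if $K^{\mathcal L}=\emptyset^\ell$ then $\ell\le s$ for every atom $\emptyset^s$ occurring in $K$, and if $K^{\mathcal R}=\emptyset^r$ then $s\le r$ for every atom $\emptyset^s$ occurring in $K$; $\mathbb{GS}$ is the class of guaranteed games. Disjunctive sum $G+H$: Left options are $G^L+H$ and $G+H^L$, except if both are left-atomic with atoms $\emptyset^{\ell_1},\emptyset^{\ell_2}$, then $(G+H)^{\mathcal L}=\emptyset^{\ell_1+\ell_2}$; Right symmetric. Stops: $Ls(G)=\ell$ if $G^{\mathcal L}=\emptyset^\ell$, otherwise $\max_{G^L}Rs(G^L)$; $Rs(G)=r$ if $G^{\mathcal R}=\emptyset^r$, otherwise $\min_{G^R}Ls(G^R)$. Conjugate: $\overleftrightarrow{G}=\langle\overleftrightarrow{G^{\mathcal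 R}}\mid\overleftrightarrow{G^{\mathcal L}}\rangle$ (atom $\emptyset^s$ becomes $\emptyset^{-s}$). Waiting moves: $\widehat 0=\langle\emptyset^0\mid\emptyset^0\rangle$, $\widehat{k+1}=\langle\widehat k\mid\emptyset^0\rangle$, $-\widehat k=\overleftrightarrow{\widehat k}$. Pass-allowed stops (over integers $k\ge0$): $\underline{Ls}(G)=\min_k Ls(G-\widehat k)$, $\overline{Ls}(G)=\max_k Ls(G+\widehat k)$, $\overline{Rs}(G)=\max_k Rs(G+\widehat k)$, $\underline{Rs}(G)=\min_k Rs(G-\widehat k)$. *)

theory Defs
  imports Complex_Main "HOL-Library.FSet"
begin

datatype 'g side = Atom real | Options "'g fset"

datatype game = Game (lefts: "game side") (rights: "game side")

fun opts :: "'g side \<Rightarrow> 'g fset" where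
  "opts (Atom s) = {||}"
| "opts (Options X) = X"

inductive follower :: "game \<Rightarrow> game \<Rightarrow> bool" where
  refl: "follower G G"
| left: "G' |\<in>| opts (lefts G) \<Longrightarrow> follower K G' \<Longrightarrow> follower K G"
| right: "G' |\<in>| opts (rights G) \<Longrightarrow> follower K G' \<Longrightarrow> follower K G"

text \<open>The datatype also admits empty option sets, which do not occur in scoring games.\<close>

definition scoring_game :: "game \<Rightarrow> bool" where
  "scoring_game G \<longleftrightarrow>
     (\<forall>K. follower K G \<longrightarrow> lefts K \<noteq> Options {||} \<and> rights K \<noteq> Options {||})"

definition atom_in :: "real \<Rightarrow> game \<Rightarrow> bool" where
  "atom_in s G \<longleftrightarrow> (\<exists>K. follower K G \<and> (lefts K = Atom s \<or> rights K = Atom s))"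

definition guaranteed :: "game \<Rightarrow> bool" where
  "guaranteed G \<longleftrightarrow> (\<forall>K. follower K G \<longrightarrow>
     (\<forall>l. lefts K = Atom l \<longrightarrow> (\<forall>s. atom_in s K \<longrightarrow> l \<le> s)) \<and>
     (\<forall>r. rights K = Atom r \<longrightarrow> (\<forall>s. atom_in s K \<longrightarrow> s \<le> r)))"

definition GS :: "game set" where
  "GS = {G. scoring_game G \<and> guaranteed G}"

lemma size_option: "g |\<in>| X \<Longrightarrow> size g < size_side size (Options X)"
proof -
  assume "g |\<in>| X"
  then have "Suc (size g) \<le> (\<Sum>x\<in>fset X. Suc (size x))"
    by (intro member_le_sum) auto
  then show ?thesis by (simp add: size_fset_simps)
qed

lemma size_opts_lefts: "G' |\<in>| opts (lefts G) \<Longrightarrow> size G' < size G"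
  by (cases G; cases "lefts G") (auto dest!: size_option)

lemma size_opts_rights: "G' |\<in>| opts (rights G) \<Longrightarrow> size G' < size G"
  by (cases G; cases "rights G") (auto dest!: size_option)

function gsum :: "game \<Rightarrow> game \<Rightarrow> game" where
  "gsum G H = Game
     (case (lefts G, lefts H) of
        (Atom l1, Atom l2) \<Rightarrow> Atom (l1 + l2)
      | _ \<Rightarrow> Options ((\<lambda>G'. gsum G' H) |`| opts (lefts G) |\<union>| (\<lambda>H'. gsum G H') |`| opts (lefts H)))
     (case (rights G, rights H) of
        (Atom r1, Atom r2) \<Rightarrow> Atom (r1 + r2)
      | _ \<Rightarrow> Options ((\<lambda>G'. gsum G' H) |`| opts (rights G) |\<union>| (\<lambda>H'. gsum G H') |`| opts (rights H)))"
  by pat_completeness auto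
termination
  by (relation "measure (\<lambda>(G, H). size G + size H)")
    (auto dest: size_opts_lefts size_opts_rights)

function Ls :: "game \<Rightarrow> real" and Rs :: "game \<Rightarrow> real" where
  "Ls G = (case lefts G of Atom l \<Rightarrow> l | Options X \<Rightarrow> Max (Rs ` fset X))"
| "Rs G = (case rights G of Atom r \<Rightarrow> r | Options X \<Rightarrow> Min (Ls ` fset X))"
  by pat_completeness auto
termination
  by (relation "measure (case_sum size size)")
    (auto intro: size_opts_lefts size_opts_rights)

function conjugate :: "game \<Rightarrow> game" where
  "conjugate G = Game
     (case rights G of Atom s \<Rightarrow> Atom (- s) | Options X \<Rightarrow> Options (conjugate |`| X))
     (case lefts G of Atom s \<Rightarrow> Atom (- s) | Options X \<Rightarrow> Options (conjugate |`| X))"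
  by pat_completeness auto
termination
  by (relation "measure size") (auto intro: size_opts_lefts size_opts_rights)

declare gsum.simps [simp del] Ls.simps [simp del] Rs.simps [simp del] conjugate.simps [simp del]

fun waiting :: "nat \<Rightarrow> game" where
  "waiting 0 = Game (Atom 0) (Atom 0)"
| "waiting (Suc k) = Game (Options {|waiting k|}) (Atom 0)"

text \<open>The extrema below range over finite sets of reals whenever the game is a scoring
  game; see the finiteness lemma at the end of the theory.\<close>

definition Ls_lower :: "game \<Rightarrow> real" where
  "Ls_lower G = Min (range (\<lambda>k. Ls (gsum G (conjugate (waiting k)))))"

definition Ls_upper :: "game \<Rightarrow> real" where
  "Ls_upper G = Max (range (\<lambda>k. Ls (gsum G (waiting k))))"

definition Rs_upper :: "game \<Rightarrow> real" where
  "Rs_upper G = Max (range (\<lambda>k. Rs (gsum G (waiting k))))"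

definition Rs_lower :: "game \<Rightarrow> real" where
  "Rs_lower G = Min (range (\<lambda>k. Rs (gsum G (conjugate (waiting k)))))"

lemma scoring_game_option:
  assumes "scoring_game G" "G' |\<in>| opts (lefts G) \<or> G' |\<in>| opts (rights G)"
  shows "scoring_game G'"
  using assms unfolding scoring_game_def by (meson follower.left follower.right)

lemma scoring_game_nonempty:
  assumes "scoring_game G"
  shows "lefts G \<noteq> Options {||}" "rights G \<noteq> Options {||}"
  using assms follower.refl unfolding scoring_game_def by blast+

lemma atom_in_option:
  assumes "atom_in s G'" "G' |\<in>| opts (lefts G) \<or> G' |\<in>| opts (rights G)"
  shows "atom_in s G"
  using assms unfolding atom_in_def by (meson follower.left follower.right)

lemma atom_in_self: "lefts G = Atom s \<or> rights G = Atom s \<Longrightarrow> atom_in s G"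
  unfolding atom_in_def using follower.refl by blast

lemma finite_atoms: "finite {s. atom_in s G}"
proof (induction "size G" arbitrary: G rule: less_induct)
  case less
  let ?O = "fset (opts (lefts G)) \<union> fset (opts (rights G))"
  have "{s. atom_in s G} \<subseteq> (\<Union>G'\<in>?O. {s. atom_in s G'})
      \<union> {s. lefts G = Atom s} \<union> {s. rights G = Atom s}"
    unfolding atom_in_def by (auto elim: follower.cases)
  moreover have "finite {s. S = Atom s}" for S :: "game side"
    by (cases S) auto
  moreover have "finite (\<Union>G'\<in>?O. {s. atom_in s G'})"
    using less size_opts_lefts size_opts_rights by auto
  ultimately show ?case by (meson finite_UnI finite_subset)
qed

lemma stops_gsum_atoms:
  assumes "scoring_game G" "scoring_game H"
  shows "(\<exists>a b. atom_in a G \<and> atom_in b H \<and> Ls (gsum G H) = a + b) \<and>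
    (\<exists>a b. atom_in a G \<and> atom_in b H \<and> Rs (gsum G H) = a + b)"
  using assms
proof (induction "size G + size H" arbitrary: G H rule: less_induct)
  case less
  have sz: "size G' < size G" if "G' |\<in>| opts (lefts G) \<or> G' |\<in>| opts (rights G)" for G' G
    using that size_opts_lefts size_opts_rights by blast
  have IH1: "(\<exists>a b. atom_in a G \<and> atom_in b H \<and> Ls (gsum G' H) = a + b) \<and>
      (\<exists>a b. atom_in a G \<and> atom_in b H \<and> Rs (gsum G' H) = a + b)"
    if "G' |\<in>| opts (lefts G) \<or> G' |\<in>| opts (rights G)" for G'
    using less.hyps[of G' H] sz[OF that] scoring_game_option[OF less.prems(1) that]
      less.prems(2) atom_in_option[OF _ that] by (meson add_less_mono1)
  have IH2: "(\<exists>a b. atom_in a G \<and> atom_in b H \<and> Ls (gsum G H') = a + b) \<and>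
      (\<exists>a b. atom_in a G \<and> atom_in b H \<and> Rs (gsum G H') = a + b)"
    if "H' |\<in>| opts (lefts H) \<or> H' |\<in>| opts (rights H)" for H'
    using less.hyps[of G H'] sz[OF that] scoring_game_option[OF less.prems(2) that]
      less.prems(1) atom_in_option[OF _ that] by (meson add_less_cancel_left)
  have "\<exists>a b. atom_in a G \<and> atom_in b H \<and> Ls (gsum G H) = a + b"
  proof (cases "\<exists>l1 l2. lefts G = Atom l1 \<and> lefts H = Atom l2")
    case True
    then obtain l1 l2 where eq: "lefts G = Atom l1" "lefts H = Atom l2" by blast
    then have "Ls (gsum G H) = l1 + l2"
      by (subst Ls.simps, subst gsum.simps) simp
    with eq show ?thesis using atom_in_self by blast
  next
    case False
    define X where "X = (\<lambda>G'. gsum G' H) |`| opts (lefts G) |\<union>| (\<lambda>H'. gsum G H') |`| opts (lefts H)"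
    have "lefts (gsum G H) = Options X"
      using False by (auto simp: gsum.simps[of G H] X_def split: side.splits)
    then have "Ls (gsum G H) = Max (Rs ` fset X)"
      by (simp add: Ls.simps[of "gsum G H"])
    moreover have "X \<noteq> {||}"
      using False scoring_game_nonempty(1)[OF less.prems(1)] scoring_game_nonempty(1)[OF less.prems(2)]
      unfolding X_def by (cases "lefts G"; cases "lefts H") auto
    then have "Max (Rs ` fset X) \<in> Rs ` fset X"
      by (intro Max_in) auto
    ultimately show ?thesis using IH1 IH2 unfolding X_def by auto
  qed
  moreover have "\<exists>a b. atom_in a G \<and> atom_in b H \<and> Rs (gsum G H) = a + b"
  proof (cases "\<exists>r1 r2. rights G = Atom r1 \<and> rights H = Atom r2")
    case True
    then obtain r1 r2 where eq: "rights G = Atom r1" "rights H = Atom r2" by blast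
    then have "Rs (gsum G H) = r1 + r2"
      by (subst Rs.simps, subst gsum.simps) simp
    with eq show ?thesis using atom_in_self by blast
  next
    case False
    define X where "X = (\<lambda>G'. gsum G' H) |`| opts (rights G) |\<union>| (\<lambda>H'. gsum G H') |`| opts (rights H)"
    have "rights (gsum G H) = Options X"
      using False by (auto simp: gsum.simps[of G H] X_def split: side.splits)
    then have "Rs (gsum G H) = Min (Ls ` fset X)"
      by (simp add: Rs.simps[of "gsum G H"])
    moreover have "X \<noteq> {||}"
      using False scoring_game_nonempty(2)[OF less.prems(1)] scoring_game_nonempty(2)[OF less.prems(2)]
      unfolding X_def by (cases "rights G"; cases "rights H") auto
    then have "Min (Ls ` fset X) \<in> Ls ` fset X"
      by (intro Min_in) auto
    ultimately show ?thesis using IH1 IH2 unfolding X_def by auto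
  qed
  ultimately show ?case by blast
qed

lemma waiting_sides:
  "lefts (waiting k) = (if k = 0 then Atom 0 else Options {|waiting (k - 1)|})"
  "rights (waiting k) = Atom 0"
  "lefts (conjugate (waiting k)) = Atom 0"
  "rights (conjugate (waiting k)) = (if k = 0 then Atom 0 else Options {|conjugate (waiting (k - 1))|})"
  by (cases k; (subst conjugate.simps)?; simp)+

lemma follower_waiting: "follower K (waiting k) \<Longrightarrow> \<exists>j. K = waiting j"
proof (induction k)
  case 0
  from 0 show ?case
    by (cases rule: follower.cases) (auto simp: waiting_sides simp del: waiting.simps)
next
  case (Suc k)
  from Suc.prems show ?case
    by (cases rule: follower.cases)
      (use Suc.IH in \<open>auto simp: waiting_sides simp del: waiting.simps\<close>)
qed

lemma follower_conjugate_waiting: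
  "follower K (conjugate (waiting k)) \<Longrightarrow> \<exists>j. K = conjugate (waiting j)"
proof (induction k)
  case 0
  from 0 show ?case
    by (cases rule: follower.cases) (auto simp: waiting_sides simp del: waiting.simps)
next
  case (Suc k)
  from Suc.prems show ?case
    by (cases rule: follower.cases)
      (use Suc.IH in \<open>auto simp: waiting_sides simp del: waiting.simps\<close>)
qed

lemma scoring_game_waiting: "scoring_game (waiting k)" "scoring_game (conjugate (waiting k))"
  unfolding scoring_game_def
  by (auto dest!: follower_waiting follower_conjugate_waiting simp: waiting_sides split: if_splits)

lemma atom_in_waiting:
  "atom_in s (waiting k) \<Longrightarrow> s = 0" "atom_in s (conjugate (waiting k)) \<Longrightarrow> s = 0"
  unfolding atom_in_def
  by (auto dest!: follower_waiting follower_conjugate_waiting simp: waiting_sides split: if_splits)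

lemma finite_pass_allowed_stops:
  assumes "scoring_game G"
  shows "finite (range (\<lambda>k. Ls (gsum G (conjugate (waiting k)))))"
    and "finite (range (\<lambda>k. Ls (gsum G (waiting k))))"
    and "finite (range (\<lambda>k. Rs (gsum G (waiting k))))"
    and "finite (range (\<lambda>k. Rs (gsum G (conjugate (waiting k)))))"
proof -
  have fin: "finite (range f)" if "\<And>k. atom_in (f k) G" for f :: "nat \<Rightarrow> real"
    by (rule finite_subset[OF _ finite_atoms[of G]]) (use that in auto)
  have "atom_in (Ls (gsum G (waiting k))) G \<and> atom_in (Rs (gsum G (waiting k))) G" for k
    using stops_gsum_atoms[OF assms scoring_game_waiting(1)[of k]] atom_in_waiting(1)[of _ k]
    by (metis add.right_neutral)
  moreover have "atom_in (Ls (gsum G (conjugate (waiting k)))) G \<and>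
      atom_in (Rs (gsum G (conjugate (waiting k)))) G" for k
    using stops_gsum_atoms[OF assms scoring_game_waiting(2)[of k]] atom_in_waiting(2)[of _ k]
    by (metis add.right_neutral)
  ultimately show "finite (range (\<lambda>k. Ls (gsum G (conjugate (waiting k)))))"
    and "finite (range (\<lambda>k. Ls (gsum G (waiting k))))"
    and "finite (range (\<lambda>k. Rs (gsum G (waiting k))))"
    and "finite (range (\<lambda>k. Rs (gsum G (conjugate (waiting k)))))"
    by (blast intro: fin)+
qed

end

theory Submission
  imports Defs
begin

text \<open>
  Extra passes never hurt Right in a guaranteed game, so the lower pass-allowed stops are the
  eventually constant values of the stops of \<open>G - k\<close>. Passing to the limit gives a recursion
  without passes: the lower left stop is the atom or the maximum of the lower right stops of the
  left options, and the lower right stop is the minimum of the lower left stop of \<open>G\<close> itself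
  and those of its right options. Since guaranteed games are closed under sums, both bounds for
  the left stop follow by induction together with the companions
  \<open>R(G) + R(H) \<le> R(G + H) \<le> R(G) + L(H)\<close>; the only delicate case of the lower bound is a
  left-atomic \<open>G\<close>, where the guarantee forces \<open>L(G) = R(G)\<close>.
  Conjugation yields the statements about upper stops.
\<close>

section \<open>Closure properties of guaranteed games\<close>

lemma follower_option:
  assumes "G' |\<in>| opts (lefts G) \<or> G' |\<in>| opts (rights G)" "follower K G'"
  shows "follower K G"
  using assms follower.left follower.right by blast

lemma GS_option:
  assumes "G \<in> GS" "G' |\<in>| opts (lefts G) \<or> G' |\<in>| opts (rights G)"
  shows "G' \<in> GS"
  using assms follower_option[OF assms(2)] unfolding GS_def scoring_game_def guaranteed_def by blast

lemma GS_scoring: "G \<in> GS \<Longrightarrow> scoring_game G"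
  by (simp add: GS_def)

lemma GS_left_atom_le: "G \<in> GS \<Longrightarrow> lefts G = Atom l \<Longrightarrow> atom_in s G \<Longrightarrow> l \<le> s"
  unfolding GS_def guaranteed_def using follower.refl by blast

lemma GS_right_atom_ge: "G \<in> GS \<Longrightarrow> rights G = Atom r \<Longrightarrow> atom_in s G \<Longrightarrow> s \<le> r"
  unfolding GS_def guaranteed_def using follower.refl by blast

lemma GS_follower: "G \<in> GS \<Longrightarrow> follower K G \<Longrightarrow> K \<in> GS"
proof -
  assume "follower K G" "G \<in> GS"
  then show "K \<in> GS"
    by (induction rule: follower.induct) (auto intro: GS_option)
qed

text \<open>Collects all conditions under one quantifier over followers, so that closure under an
  operation can be checked one follower at a time.\<close>

lemma GS_iff:
  "G \<in> GS \<longleftrightarrow> (\<forall>K. follower K G \<longrightarrow> lefts K \<noteq> Options {||} \<and> rights K \<noteq> Options {||} \<and>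
     (\<forall>l s. lefts K = Atom l \<longrightarrow> atom_in s K \<longrightarrow> l \<le> s) \<and>
     (\<forall>r s. rights K = Atom r \<longrightarrow> atom_in s K \<longrightarrow> s \<le> r))"
  unfolding GS_def scoring_game_def guaranteed_def by blast

text \<open>Uniform in the shape of the sides: when both summands are atomic, the union on the right
  is empty, and so is \<open>opts\<close> of the resulting atom.\<close>

lemma opts_gsum:
  "opts (lefts (gsum G H)) =
     (\<lambda>G'. gsum G' H) |`| opts (lefts G) |\<union>| (\<lambda>H'. gsum G H') |`| opts (lefts H)"
  "opts (rights (gsum G H)) =
     (\<lambda>G'. gsum G' H) |`| opts (rights G) |\<union>| (\<lambda>H'. gsum G H') |`| opts (rights H)"
  by (auto simp: gsum.simps[of G H] split: side.splits)

lemma gsum_eq_Atom_iff: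
  "lefts (gsum G H) = Atom s \<longleftrightarrow> (\<exists>a b. lefts G = Atom a \<and> lefts H = Atom b \<and> s = a + b)"
  "rights (gsum G H) = Atom s \<longleftrightarrow> (\<exists>a b. rights G = Atom a \<and> rights H = Atom b \<and> s = a + b)"
  by (auto simp: gsum.simps[of G H] split: side.splits)

lemma gsum_neq_empty:
  "lefts G \<noteq> Options {||} \<Longrightarrow> lefts H \<noteq> Options {||} \<Longrightarrow> lefts (gsum G H) \<noteq> Options {||}"
  "rights G \<noteq> Options {||} \<Longrightarrow> rights H \<noteq> Options {||} \<Longrightarrow> rights (gsum G H) \<noteq> Options {||}"
  by (auto simp: gsum.simps[of G H] split: side.splits)

text \<open>Each move in a sum is a move in exactly one summand, so a sequence of moves splits into
  one sequence per summand.\<close>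

lemma follower_gsum:
  assumes "follower K (gsum G H)"
  shows "\<exists>G' H'. follower G' G \<and> follower H' H \<and> K = gsum G' H'"
  using assms
proof (induction K "gsum G H" arbitrary: G H rule: follower.induct)
  case refl
  then show ?case using follower.refl by blast
next
  case (left M K)
  from left.hyps(1) consider
      G' where "G' |\<in>| opts (lefts G)" "M = gsum G' H"
    | H' where "H' |\<in>| opts (lefts H)" "M = gsum G H'"
    by (auto simp: opts_gsum)
  then show ?case
    by cases (use left.hyps(3) follower.left in blast)+
next
  case (right M K)
  from right.hyps(1) consider
      G' where "G' |\<in>| opts (rights G)" "M = gsum G' H"
    | H' where "H' |\<in>| opts (rights H)" "M = gsum G H'"
    by (auto simp: opts_gsum)
  then show ?case
    by cases (use right.hyps(3) follower.right in blast)+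
qed

text \<open>A follower of the sum is a sum of followers, and its side is an atom only if both
  summands are atomic on that side.\<close>

lemma atom_in_gsum:
  assumes "atom_in s (gsum G H)"
  shows "\<exists>a b. atom_in a G \<and> atom_in b H \<and> s = a + b"
proof -
  from assms obtain K where K: "follower K (gsum G H)" "lefts K = Atom s \<or> rights K = Atom s"
    unfolding atom_in_def by blast
  from follower_gsum[OF K(1)] obtain G' H' where "follower G' G" "follower H' H" "K = gsum G' H'"
    by blast
  with K(2) show ?thesis
    unfolding atom_in_def by (auto simp: gsum_eq_Atom_iff)
qed

text \<open>A left atom of a follower is the sum of the left atoms of its two summands. Each of
  these bounds every atom of its own summand from below, and atoms of a sum are sums of atoms, so
  the bounds add up. The right side is dual.\<close>

lemma GS_gsum:
  assumes "G \<in> GS" "H \<in> GS"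
  shows "gsum G H \<in> GS"
  unfolding GS_iff[of "gsum G H"]
proof (intro allI impI)
  fix K assume "follower K (gsum G H)"
  then obtain G' H' where *: "follower G' G" "follower H' H" "K = gsum G' H'"
    using follower_gsum by blast
  with assms have GS: "G' \<in> GS" "H' \<in> GS"
    by (auto intro: GS_follower)
  have "l \<le> s" if "lefts K = Atom l" "atom_in s K" for l s
    using that * GS_left_atom_le[OF GS(1)] GS_left_atom_le[OF GS(2)]
    by (auto simp: gsum_eq_Atom_iff dest!: atom_in_gsum intro: add_mono)
  moreover have "s \<le> r" if "rights K = Atom r" "atom_in s K" for r s
    using that * GS_right_atom_ge[OF GS(1)] GS_right_atom_ge[OF GS(2)]
    by (auto simp: gsum_eq_Atom_iff dest!: atom_in_gsum intro: add_mono)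
  ultimately show "lefts K \<noteq> Options {||} \<and> rights K \<noteq> Options {||} \<and>
     (\<forall>l s. lefts K = Atom l \<longrightarrow> atom_in s K \<longrightarrow> l \<le> s) \<and>
     (\<forall>r s. rights K = Atom r \<longrightarrow> atom_in s K \<longrightarrow> s \<le> r)"
    using *(3) gsum_neq_empty[of G' H'] GS[THEN GS_scoring, THEN scoring_game_nonempty(1)]
      GS[THEN GS_scoring, THEN scoring_game_nonempty(2)] by simp
qed

section \<open>Stops with boundedly many passes for Right\<close>

declare waiting.simps [simp del]

text \<open>\<open>conjugate (waiting k)\<close> gives Right \<open>k\<close> successive moves and
  Left none, and all its atoms are 0. Adding it amounts to allowing Right \<open>k\<close>
  passes.\<close>

abbreviation Ls_pass :: "game \<Rightarrow> nat \<Rightarrow> real" where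
  "Ls_pass G k \<equiv> Ls (gsum G (conjugate (waiting k)))"

abbreviation Rs_pass :: "game \<Rightarrow> nat \<Rightarrow> real" where
  "Rs_pass G k \<equiv> Rs (gsum G (conjugate (waiting k)))"

lemma Ls_pass_Atom:
  assumes "lefts G = Atom l"
  shows "Ls_pass G k = l"
proof -
  have "lefts (gsum G (conjugate (waiting k))) = Atom l"
    using assms by (simp add: gsum_eq_Atom_iff waiting_sides)
  then show ?thesis by (simp add: Ls.simps)
qed

lemma Ls_pass_Options:
  assumes "lefts G = Options X"
  shows "Ls_pass G k = Max ((\<lambda>G'. Rs_pass G' k) ` fset X)"
proof -
  have "lefts (gsum G (conjugate (waiting k))) =
      Options ((\<lambda>G'. gsum G' (conjugate (waiting k))) |`| X)"
    by (simp add: gsum.simps[of G] assms waiting_sides(3))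
  then show ?thesis by (simp add: Ls.simps[of "gsum G _"] image_image)
qed

lemma Rs_pass_0_Atom:
  assumes "rights G = Atom r"
  shows "Rs_pass G 0 = r"
proof -
  have "rights (gsum G (conjugate (waiting 0))) = Atom r"
    using assms by (simp add: gsum_eq_Atom_iff waiting_sides)
  then show ?thesis by (simp add: Rs.simps)
qed

lemma Rs_pass_0_Options:
  assumes "rights G = Options X"
  shows "Rs_pass G 0 = Min ((\<lambda>G'. Ls_pass G' 0) ` fset X)"
proof -
  have "rights (gsum G (conjugate (waiting 0))) =
      Options ((\<lambda>G'. gsum G' (conjugate (waiting 0))) |`| X)"
    by (simp add: gsum.simps[of G] assms waiting_sides(4))
  then show ?thesis by (simp add: Rs.simps[of "gsum G _"] image_image)
qed

text \<open>While a pass is left the sum is not right-atomic, so the formula also covers a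
  right-atomic \<open>G\<close>. The inserted value is the result of using a pass.\<close>

lemma Rs_pass_Suc:
  "Rs_pass G (Suc k) =
     Min (insert (Ls_pass G k) ((\<lambda>G'. Ls_pass G' (Suc k)) ` fset (opts (rights G))))"
proof -
  have "rights (gsum G (conjugate (waiting (Suc k)))) =
      Options (finsert (gsum G (conjugate (waiting k)))
        ((\<lambda>G'. gsum G' (conjugate (waiting (Suc k)))) |`| opts (rights G)))"
    by (cases "rights G") (simp_all add: gsum.simps[of G] waiting_sides(4))
  then show ?thesis by (simp add: Rs.simps[of "gsum G _"] image_image)
qed

text \<open>Passes contribute only the score 0, so a stop with passes is still an atom of
  \<open>G\<close> and can be compared with the guaranteed atoms.\<close>

lemma atom_in_pass:
  assumes "scoring_game G"
  shows "atom_in (Ls_pass G k) G" "atom_in (Rs_pass G k) G"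
  using stops_gsum_atoms[OF assms scoring_game_waiting(2)[of k]] atom_in_waiting(2)[of _ k]
  by (metis add.right_neutral)+

lemma Max_image_mono:
  fixes f g :: "'a \<Rightarrow> 'b::linorder"
  assumes "finite A" "A \<noteq> {}" "\<And>x. x \<in> A \<Longrightarrow> f x \<le> g x"
  shows "Max (f ` A) \<le> Max (g ` A)"
  using assms by (intro Max.boundedI) (auto intro: order_trans[OF _ Max_ge])

text \<open>An additional pass only enlarges Right's choice, except where Right could not move at
  all and is now obliged to spend the pass. The measure \<open>size G + k\<close> decreases both
  when an option is taken and when a pass is used.\<close>

lemma pass_Suc_le:
  assumes "G \<in> GS"
  shows "Ls_pass G (Suc k) \<le> Ls_pass G k \<and> Rs_pass G (Suc k) \<le> Rs_pass G k"
  using assms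
proof (induction "size G + k" arbitrary: G k rule: less_induct)
  case less
  have left: "Ls_pass G (Suc k) \<le> Ls_pass G k"
  proof (cases "lefts G")
    case (Options X)
    have "Rs_pass G' (Suc k) \<le> Rs_pass G' k" if "G' \<in> fset X" for G'
      using less.hyps[of G' k] size_opts_lefts[of G' G] GS_option[OF less.prems, of G'] that Options
      by simp
    moreover have "fset X \<noteq> {}"
      using scoring_game_nonempty(1)[OF GS_scoring[OF less.prems]] Options by auto
    ultimately show ?thesis
      unfolding Ls_pass_Options[OF Options] by (intro Max_image_mono) auto
  qed (simp add: Ls_pass_Atom)
  have opt: "Ls_pass G' (Suc k) \<le> Ls_pass G' k" if "G' |\<in>| opts (rights G)" for G'
    using less.hyps[of G' k] size_opts_rights[OF that] GS_option[OF less.prems, of G'] that by simp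
  have le_opt: "Rs_pass G (Suc k) \<le> Ls_pass G' k" if "G' |\<in>| opts (rights G)" for G'
    unfolding Rs_pass_Suc by (rule order_trans[OF Min_le opt[OF that]]) (use that in auto)
  have le_self: "Rs_pass G (Suc k) \<le> Ls_pass G k"
    by (simp add: Rs_pass_Suc)
  have "Rs_pass G (Suc k) \<le> Rs_pass G k"
  proof (cases k)
    case 0
    show ?thesis
    proof (cases "rights G")
      case (Atom r)
      \<comment> \<open>The guarantee enters here: spending the only pass leads to an atom of
        \<open>G\<close>, which is at most the right atom \<open>r\<close> that Right would get
        without a pass.\<close>
      then show ?thesis
        using 0 GS_right_atom_ge[OF less.prems Atom atom_in_pass(1)[OF GS_scoring[OF less.prems]]]
        by (simp add: Rs_pass_Suc Rs_pass_0_Atom)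
    next
      case (Options X)
      have "fset X \<noteq> {}"
        using scoring_game_nonempty(2)[OF GS_scoring[OF less.prems]] Options by auto
      then show ?thesis
        unfolding 0 Rs_pass_0_Options[OF Options] using le_opt[unfolded 0] Options
        by (intro Min.boundedI) auto
    qed
  next
    case (Suc j)
    \<comment> \<open>Compares the two passing moves: the same game \<open>G\<close>, with one pass
      fewer on each side.\<close>
    have "Ls_pass G (Suc j) \<le> Ls_pass G j"
      using less.hyps[of G j] less.prems Suc by simp
    then show ?thesis
      unfolding Suc Rs_pass_Suc[of G j] using le_opt[unfolded Suc] le_self[unfolded Suc]
      by (intro Min.boundedI) auto
  qed
  with left show ?case by blast
qed

text \<open>A finite range attains its minimum, and a decreasing sequence stays there once it has
  reached it.\<close>

lemma eventually_eq_Min_range: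
  fixes f :: "nat \<Rightarrow> 'a::linorder"
  assumes "finite (range f)" "decseq f"
  shows "\<forall>\<^sub>F k in sequentially. f k = Min (range f)"
proof -
  have "Min (range f) \<in> range f"
    using assms(1) by (intro Min_in) auto
  then obtain N where N: "f N = Min (range f)" by (metis imageE)
  have "f k = Min (range f)" if "k \<ge> N" for k
    using N decseqD[OF assms(2) that] Min_le[OF assms(1), of "f k"] by auto
  then show ?thesis
    by (auto simp: eventually_sequentially)
qed

text \<open>Replaces the minimum over all \<open>k\<close> by the value at any large
  \<open>k\<close>, so that finitely many games can be evaluated with one common number of
  passes.\<close>

lemma eventually_pass_eq_lower:
  assumes "G \<in> GS"
  shows "\<forall>\<^sub>F k in sequentially. Ls_pass G k = Ls_lower G"
    and "\<forall>\<^sub>F k in sequentially. Rs_pass G k = Rs_lower G"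
proof -
  have "decseq (Ls_pass G)" "decseq (Rs_pass G)"
    using pass_Suc_le[OF assms] by (auto intro!: decseq_SucI)
  then show "\<forall>\<^sub>F k in sequentially. Ls_pass G k = Ls_lower G"
    and "\<forall>\<^sub>F k in sequentially. Rs_pass G k = Rs_lower G"
    unfolding Ls_lower_def Rs_lower_def
    using finite_pass_allowed_stops[OF GS_scoring[OF assms]]
    by (auto intro!: eventually_eq_Min_range)
qed

section \<open>The recursion for the lower pass-allowed stops\<close>

lemma Ls_lower_Atom: "lefts G = Atom l \<Longrightarrow> Ls_lower G = l"
  by (simp add: Ls_lower_def Ls_pass_Atom)

text \<open>There are finitely many left options, so for large \<open>k\<close> all of them have
  reached their limits at once, and the recursion for \<open>Ls_pass\<close> carries over.\<close>

lemma Ls_lower_Options: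
  assumes "G \<in> GS" "lefts G = Options X"
  shows "Ls_lower G = Max (Rs_lower ` fset X)"
proof -
  have "\<forall>\<^sub>F k in sequentially. \<forall>G'\<in>fset X. Rs_pass G' k = Rs_lower G'"
    using eventually_pass_eq_lower(2) GS_option[OF assms(1)] assms(2)
    by (intro eventually_ball_finite) auto
  then have "\<forall>\<^sub>F k in sequentially. Ls_lower G = Max (Rs_lower ` fset X)"
    using eventually_pass_eq_lower(1)[OF assms(1)]
    by eventually_elim (use Ls_pass_Options[OF assms(2)] in \<open>metis (mono_tags, lifting) image_cong\<close>)
  \<comment> \<open>The equation does not mention \<open>k\<close>; holding for large
    \<open>k\<close>, it simply holds.\<close>
  then show ?thesis by simp
qed

text \<open>In the limit a pass costs nothing: after it Left is to move in the same
  \<open>G\<close>, still against unboundedly many passes. If \<open>G\<close> is right-atomic, only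
  this term remains.\<close>

lemma Rs_lower_rec:
  assumes "G \<in> GS"
  shows "Rs_lower G = Min (insert (Ls_lower G) (Ls_lower ` fset (opts (rights G))))"
proof -
  \<comment> \<open>The index is shifted because \<open>Rs_pass_Suc\<close> evaluates the options
    with \<open>Suc k\<close> passes, but \<open>G\<close> itself, after a pass, with
    \<open>k\<close>.\<close>
  have "\<forall>\<^sub>F k in sequentially. Ls_pass G' (Suc k) = Ls_lower G'"
    if "G' |\<in>| opts (rights G)" for G'
    using eventually_pass_eq_lower(1)[OF GS_option[OF assms]] that
    by (subst eventually_sequentially_Suc) blast
  then have "\<forall>\<^sub>F k in sequentially. \<forall>G'\<in>fset (opts (rights G)). Ls_pass G' (Suc k) = Ls_lower G'"
    by (intro eventually_ball_finite) auto
  moreover have "\<forall>\<^sub>F k in sequentially. Rs_pass G (Suc k) = Rs_lower G"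
    using eventually_pass_eq_lower(2)[OF assms] by (subst eventually_sequentially_Suc)
  ultimately have "\<forall>\<^sub>F k in sequentially.
      Rs_lower G = Min (insert (Ls_lower G) (Ls_lower ` fset (opts (rights G))))"
    using eventually_pass_eq_lower(1)[OF assms]
    by eventually_elim (use Rs_pass_Suc in \<open>metis (mono_tags, lifting) image_cong\<close>)
  then show ?thesis by simp
qed

lemma Rs_lower_le_Ls_lower: "G \<in> GS \<Longrightarrow> Rs_lower G \<le> Ls_lower G"
  by (simp add: Rs_lower_rec)

lemma Rs_lower_le_option: "G \<in> GS \<Longrightarrow> G' |\<in>| opts (rights G) \<Longrightarrow> Rs_lower G \<le> Ls_lower G'"
  by (simp add: Rs_lower_rec)

lemma Rs_lower_cases:
  assumes "G \<in> GS"
  obtains "Rs_lower G = Ls_lower G"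
  | G' where "G' |\<in>| opts (rights G)" "Rs_lower G = Ls_lower G'"
proof -
  have "Rs_lower G \<in> insert (Ls_lower G) (Ls_lower ` fset (opts (rights G)))"
    unfolding Rs_lower_rec[OF assms] by (rule Min_in) auto
  then show ?thesis using that by auto
qed

lemma Rs_lower_le_Ls_lower_option:
  assumes "G \<in> GS" "G' |\<in>| opts (lefts G)"
  shows "Rs_lower G' \<le> Ls_lower G"
proof (cases "lefts G")
  case (Options X)
  then show ?thesis
    using assms by (simp add: Ls_lower_Options)
qed (use assms in auto)

lemma Ls_lower_cases:
  assumes "G \<in> GS"
  obtains l where "lefts G = Atom l" "Ls_lower G = l"
  | G' where "G' |\<in>| opts (lefts G)" "Ls_lower G = Rs_lower G'"
proof (cases "lefts G")
  case (Atom l)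
  then show ?thesis using that Ls_lower_Atom by blast
next
  case (Options X)
  then have "fset X \<noteq> {}"
    using scoring_game_nonempty(1)[OF GS_scoring[OF assms]] by auto
  then have "Ls_lower G \<in> Rs_lower ` fset X"
    unfolding Ls_lower_Options[OF assms Options] by (intro Max_in) auto
  then show ?thesis using that Options by auto
qed

text \<open>The lower right stop is attained and is an atom of \<open>G\<close>, hence at least the
  guaranteed minimum \<open>l\<close>; and it never exceeds the lower left stop, which is
  \<open>l\<close>.\<close>

lemma Rs_lower_left_atom:
  assumes "G \<in> GS" "lefts G = Atom l"
  shows "Rs_lower G = l"
proof (rule antisym)
  show "Rs_lower G \<le> l"
    using Rs_lower_le_Ls_lower assms Ls_lower_Atom by metis
  have "Rs_lower G \<in> range (Rs_pass G)"
    unfolding Rs_lower_def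
    using finite_pass_allowed_stops(4)[OF GS_scoring[OF assms(1)]] by (intro Min_in) auto
  then show "l \<le> Rs_lower G"
    using GS_left_atom_le[OF assms] atom_in_pass(2)[OF GS_scoring[OF assms(1)]] by auto
qed

section \<open>Lower stops of sums\<close>

lemma gsum_commute: "gsum G H = gsum H G"
proof (induction "size G + size H" arbitrary: G H rule: less_induct)
  case less
  have "gsum G' H = gsum H G'" if "G' |\<in>| opts (lefts G) \<or> G' |\<in>| opts (rights G)" for G'
    using less[of G' H] that size_opts_lefts size_opts_rights by auto
  moreover have "gsum G H' = gsum H' G" if "H' |\<in>| opts (lefts H) \<or> H' |\<in>| opts (rights H)" for H'
    using less[of G H'] that size_opts_lefts size_opts_rights by auto
  ultimately have eq: "(\<lambda>G'. gsum G' H) |`| opts (lefts G) = (\<lambda>G'. gsum H G') |`| opts (lefts G)"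
    "(\<lambda>G'. gsum G' H) |`| opts (rights G) = (\<lambda>G'. gsum H G') |`| opts (rights G)"
    "(\<lambda>H'. gsum G H') |`| opts (lefts H) = (\<lambda>H'. gsum H' G) |`| opts (lefts H)"
    "(\<lambda>H'. gsum G H') |`| opts (rights H) = (\<lambda>H'. gsum H' G) |`| opts (rights H)"
    by (auto intro!: fset.map_cong)
  show ?case
    unfolding gsum.simps[of G H] gsum.simps[of H G] eq
    by (auto simp: add.commute sup_commute split: side.splits)
qed

text \<open>Left plays an optimal move of one summand, and the third bound applies to the result.
  The second bound mirrors the first; it is what the third one uses when Right replies in
  \<open>H\<close>.\<close>

lemma gsum_lower_ge:
  assumes "G \<in> GS" "H \<in> GS"
  shows "Ls_lower G + Rs_lower H \<le> Ls_lower (gsum G H) \<and>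
    Rs_lower G + Ls_lower H \<le> Ls_lower (gsum G H) \<and>
    Rs_lower G + Rs_lower H \<le> Rs_lower (gsum G H)"
  using assms
proof (induction "size G + size H" arbitrary: G H rule: less_induct)
  case less
  note GS_sum = GS_gsum[OF less.prems]
  have IH1: "Ls_lower G' + Rs_lower H \<le> Ls_lower (gsum G' H) \<and>
      Rs_lower G' + Rs_lower H \<le> Rs_lower (gsum G' H)"
    if "G' |\<in>| opts (lefts G) \<or> G' |\<in>| opts (rights G)" for G'
    using less.hyps[of G' H] that size_opts_lefts size_opts_rights GS_option[OF less.prems(1) that]
      less.prems by auto
  have IH2: "Rs_lower G + Ls_lower H' \<le> Ls_lower (gsum G H') \<and>
      Rs_lower G + Rs_lower H' \<le> Rs_lower (gsum G H')"
    if "H' |\<in>| opts (lefts H) \<or> H' |\<in>| opts (rights H)" for H'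
    using less.hyps[of G H'] that size_opts_lefts size_opts_rights GS_option[OF less.prems(2) that]
      less.prems by auto
  have move1: "Rs_lower G' + Rs_lower H \<le> Ls_lower (gsum G H)" if "G' |\<in>| opts (lefts G)" for G'
    using IH1[of G'] that Rs_lower_le_Ls_lower_option[OF GS_sum, of "gsum G' H"]
    by (auto simp: opts_gsum)
  have move2: "Rs_lower G + Rs_lower H' \<le> Ls_lower (gsum G H)" if "H' |\<in>| opts (lefts H)" for H'
    using IH2[of H'] that Rs_lower_le_Ls_lower_option[OF GS_sum, of "gsum G H'"]
    by (auto simp: opts_gsum)
  note RL = Rs_lower_le_Ls_lower[OF less.prems(1)] Rs_lower_le_Ls_lower[OF less.prems(2)]
  have L: "Ls_lower G + Rs_lower H \<le> Ls_lower (gsum G H) \<and>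
      Rs_lower G + Ls_lower H \<le> Ls_lower (gsum G H)"
  proof (cases rule: Ls_lower_cases[OF less.prems(1)])
    case G: (1 l)
    show ?thesis
    proof (cases rule: Ls_lower_cases[OF less.prems(2)])
      case H: (1 m)
      have "Ls_lower (gsum G H) = l + m"
        using G H by (intro Ls_lower_Atom) (auto simp: gsum_eq_Atom_iff)
      then show ?thesis using G H RL by auto
    next
      \<comment> \<open>Left has no move in \<open>G\<close> and must play in \<open>H\<close>.
        Since \<open>Ls_lower G = Rs_lower G\<close>, the bound with the roles of L and R exchanged
        covers both claims.\<close>
      case (2 H')
      then show ?thesis
        using G move2[of H'] RL Rs_lower_left_atom[OF less.prems(1)] by auto
    qed
  next
    case G: (2 G')
    show ?thesis
    proof (cases rule: Ls_lower_cases[OF less.prems(2)])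
      case (1 m)
      then show ?thesis
        using G move1[of G'] RL Rs_lower_left_atom[OF less.prems(2)] by auto
    next
      case (2 H')
      then show ?thesis
        using G move1[of G'] move2[of H'] by auto
    qed
  qed
  have "Rs_lower G + Rs_lower H \<le> Rs_lower (gsum G H)"
  \<comment> \<open>Right's best play in the sum is either a pass, handled by \<open>L\<close>, or a
    move in one summand; the lower left stop of that option is at least the lower right stop of the
    summand.\<close>
  proof (cases rule: Rs_lower_cases[OF GS_sum])
    case 1
    then show ?thesis using L RL by auto
  next
    case (2 K)
    then show ?thesis
      using IH1 IH2 Rs_lower_le_option[OF less.prems(1)] Rs_lower_le_option[OF less.prems(2)]
      by (fastforce simp: opts_gsum)
  qed
  with L show ?case by blast
qed

text \<open>Right answers in the summand where Left has just moved, passing if that is best there.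
  Thus each of Left's moves is bounded by the second inequality, and the second inequality follows
  from Right's optimal choice in \<open>G\<close>.\<close>

lemma gsum_lower_le:
  assumes "G \<in> GS" "H \<in> GS"
  shows "Ls_lower (gsum G H) \<le> Ls_lower G + Ls_lower H \<and>
    Rs_lower (gsum G H) \<le> Rs_lower G + Ls_lower H"
  using assms
proof (induction "size G + size H" arbitrary: G H rule: less_induct)
  case less
  note GS_sum = GS_gsum[OF less.prems]
  have IH1: "Ls_lower (gsum G' H) \<le> Ls_lower G' + Ls_lower H \<and>
      Rs_lower (gsum G' H) \<le> Rs_lower G' + Ls_lower H"
    if "G' |\<in>| opts (lefts G) \<or> G' |\<in>| opts (rights G)" for G'
    using less.hyps[of G' H] that size_opts_lefts size_opts_rights GS_option[OF less.prems(1) that]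
      less.prems by auto
  \<comment> \<open>After a left move in \<open>H\<close> the lower right stop must fall on
    \<open>H'\<close>. The second inequality is not symmetric, so the induction hypothesis is taken
    for the swapped pair \<open>H'\<close>, \<open>G\<close>.\<close>
  have IH2: "Rs_lower (gsum G H') \<le> Rs_lower H' + Ls_lower G" if "H' |\<in>| opts (lefts H)" for H'
    using less.hyps[of H' G] that size_opts_lefts[OF that] GS_option[OF less.prems(2)] less.prems
    by (auto simp: gsum_commute[of G])
  have L: "Ls_lower (gsum G H) \<le> Ls_lower G + Ls_lower H"
  proof (cases rule: Ls_lower_cases[OF GS_sum])
    case (1 l)
    then show ?thesis by (auto simp: gsum_eq_Atom_iff Ls_lower_Atom)
  next
    case (2 K)
    then show ?thesis
      using IH1 IH2 Rs_lower_le_Ls_lower_option[OF less.prems(1)]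
        Rs_lower_le_Ls_lower_option[OF less.prems(2)]
      by (fastforce simp: opts_gsum)
  qed
  have "Rs_lower (gsum G H) \<le> Rs_lower G + Ls_lower H"
  proof (cases rule: Rs_lower_cases[OF less.prems(1)])
    case 1
    then show ?thesis using L Rs_lower_le_Ls_lower[OF GS_sum] by auto
  next
    case (2 G')
    then show ?thesis
      using IH1[of G'] Rs_lower_le_option[OF GS_sum, of "gsum G' H"] by (auto simp: opts_gsum)
  qed
  with L show ?case by blast
qed

section \<open>Conjugation\<close>

lemma conjugate_sides:
  "lefts (conjugate G) =
     (case rights G of Atom s \<Rightarrow> Atom (- s) | Options X \<Rightarrow> Options (conjugate |`| X))"
  "rights (conjugate G) =
     (case lefts G of Atom s \<Rightarrow> Atom (- s) | Options X \<Rightarrow> Options (conjugate |`| X))"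
  by (simp_all add: conjugate.simps[of G])

lemma opts_conjugate:
  "opts (lefts (conjugate G)) = conjugate |`| opts (rights G)"
  "opts (rights (conjugate G)) = conjugate |`| opts (lefts G)"
  by (auto simp: conjugate_sides split: side.splits)

lemma conjugate_eq_Atom_iff:
  "lefts (conjugate G) = Atom s \<longleftrightarrow> rights G = Atom (- s)"
  "rights (conjugate G) = Atom s \<longleftrightarrow> lefts G = Atom (- s)"
  by (auto simp: conjugate_sides split: side.splits)

lemma conjugate_eq_empty_iff:
  "lefts (conjugate G) = Options {||} \<longleftrightarrow> rights G = Options {||}"
  "rights (conjugate G) = Options {||} \<longleftrightarrow> lefts G = Options {||}"
  by (auto simp: conjugate_sides split: side.splits)

lemma conjugate_conjugate: "conjugate (conjugate G) = G"
proof (induction "size G" arbitrary: G rule: less_induct)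
  case less
  have "conjugate (conjugate G') = G'"
    if "G' |\<in>| opts (lefts G) \<or> G' |\<in>| opts (rights G)" for G'
    using less[of G'] that size_opts_lefts size_opts_rights by auto
  then have eq: "conjugate |`| conjugate |`| opts (lefts G) = opts (lefts G)"
    "conjugate |`| conjugate |`| opts (rights G) = opts (rights G)"
    by (simp_all add: fset.map_comp fset.map_ident_strong)
  show ?case
    by (rule game.expand)
      (use eq in \<open>auto simp: conjugate_sides split: side.splits\<close>)
qed

lemma conjugate_gsum: "conjugate (gsum G H) = gsum (conjugate G) (conjugate H)"
proof (induction "size G + size H" arbitrary: G H rule: less_induct)
  case less
  have "conjugate (gsum G' H) = gsum (conjugate G') (conjugate H)"
    if "G' |\<in>| opts (lefts G) \<or> G' |\<in>| opts (rights G)" for G'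
    using less[of G' H] that size_opts_lefts size_opts_rights by auto
  moreover have "conjugate (gsum G H') = gsum (conjugate G) (conjugate H')"
    if "H' |\<in>| opts (lefts H) \<or> H' |\<in>| opts (rights H)" for H'
    using less[of G H'] that size_opts_lefts size_opts_rights by auto
  ultimately have eq:
    "(\<lambda>G'. conjugate (gsum G' H)) |`| opts (lefts G) =
      (\<lambda>G'. gsum (conjugate G') (conjugate H)) |`| opts (lefts G)"
    "(\<lambda>G'. conjugate (gsum G' H)) |`| opts (rights G) =
      (\<lambda>G'. gsum (conjugate G') (conjugate H)) |`| opts (rights G)"
    "(\<lambda>H'. conjugate (gsum G H')) |`| opts (lefts H) =
      (\<lambda>H'. gsum (conjugate G) (conjugate H')) |`| opts (lefts H)"
    "(\<lambda>H'. conjugate (gsum G H')) |`| opts (rights H) =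
      (\<lambda>H'. gsum (conjugate G) (conjugate H')) |`| opts (rights H)"
    by (auto intro!: fset.map_cong)
  have "lefts (conjugate (gsum G H)) = lefts (gsum (conjugate G) (conjugate H))"
    unfolding gsum.simps[of "conjugate G" "conjugate H"] conjugate_sides
    using eq by (cases "rights G"; cases "rights H")
      (simp_all add: gsum.simps[of G H] fset.map_comp comp_def fimage_funion)
  moreover have "rights (conjugate (gsum G H)) = rights (gsum (conjugate G) (conjugate H))"
    unfolding gsum.simps[of "conjugate G" "conjugate H"] conjugate_sides
    using eq by (cases "lefts G"; cases "lefts H")
      (simp_all add: gsum.simps[of G H] fset.map_comp comp_def fimage_funion)
  ultimately show ?case by (rule game.expand[OF conjI])
qed

lemma follower_conjugate: "follower K G \<Longrightarrow> follower (conjugate K) (conjugate G)"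
proof (induction rule: follower.induct)
  case (left G' G K)
  then show ?case by (auto intro: follower.right[of "conjugate G'"] simp: opts_conjugate)
next
  case (right G' G K)
  then show ?case by (auto intro: follower.left[of "conjugate G'"] simp: opts_conjugate)
qed (rule follower.refl)

lemma atom_in_conjugate: "atom_in s G \<Longrightarrow> atom_in (- s) (conjugate G)"
  unfolding atom_in_def using follower_conjugate
  by (metis conjugate_eq_Atom_iff minus_minus)

text \<open>Negation reverses the order and conjugation exchanges the sides, so the two guarantee
  conditions turn into each other.\<close>

lemma GS_conjugate:
  assumes "G \<in> GS"
  shows "conjugate G \<in> GS"
  unfolding GS_iff[of "conjugate G"]
proof (intro allI impI)
  fix K assume "follower K (conjugate G)"
  then have K: "conjugate K \<in> GS"
    using follower_conjugate GS_follower[OF assms] conjugate_conjugate by metis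
  have "l \<le> s" if "lefts K = Atom l" "atom_in s K" for l s
    using GS_right_atom_ge[OF K _ atom_in_conjugate[OF that(2)], of "- l"] that
    by (simp add: conjugate_eq_Atom_iff)
  moreover have "s \<le> r" if "rights K = Atom r" "atom_in s K" for r s
    using GS_left_atom_le[OF K _ atom_in_conjugate[OF that(2)], of "- r"] that
    by (simp add: conjugate_eq_Atom_iff)
  ultimately show "lefts K \<noteq> Options {||} \<and> rights K \<noteq> Options {||} \<and>
     (\<forall>l s. lefts K = Atom l \<longrightarrow> atom_in s K \<longrightarrow> l \<le> s) \<and>
     (\<forall>r s. rights K = Atom r \<longrightarrow> atom_in s K \<longrightarrow> s \<le> r)"
    using scoring_game_nonempty[OF GS_scoring[OF K]] by (auto simp: conjugate_eq_empty_iff)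
qed

text \<open>Negation exchanges maximum and minimum. Being a scoring game provides the nonempty
  option sets on which this is valid.\<close>

lemma stops_conjugate:
  assumes "scoring_game G"
  shows "Ls (conjugate G) = - Rs G \<and> Rs (conjugate G) = - Ls G"
  using assms
proof (induction "size G" arbitrary: G rule: less_induct)
  case less
  have IH: "Ls (conjugate G') = - Rs G' \<and> Rs (conjugate G') = - Ls G'"
    if "G' |\<in>| opts (lefts G) \<or> G' |\<in>| opts (rights G)" for G'
    using less.hyps[of G'] that size_opts_lefts size_opts_rights scoring_game_option[OF less.prems that]
    by auto
  have "Ls (conjugate G) = - Rs G"
  proof (cases "rights G")
    case (Options X)
    then have "X \<noteq> {||}" using scoring_game_nonempty[OF less.prems] by auto
    then have ne: "fset X \<noteq> {}" by auto
    have "Ls (conjugate G) = Max ((\<lambda>G'. Rs (conjugate G')) ` fset X)"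
      using Options by (simp add: Ls.simps[of "conjugate G"] conjugate_sides image_image)
    also have "\<dots> = Max (uminus ` Ls ` fset X)"
      using IH Options by (simp add: image_image cong: image_cong)
    also have "\<dots> = - Min (Ls ` fset X)"
      using ne by (simp add: minus_Min_eq_Max)
    finally show ?thesis using Options by (simp add: Rs.simps[of G])
  qed (simp add: Ls.simps[of "conjugate G"] Rs.simps[of G] conjugate_sides)
  moreover have "Rs (conjugate G) = - Ls G"
  proof (cases "lefts G")
    case (Options X)
    then have "X \<noteq> {||}" using scoring_game_nonempty[OF less.prems] by auto
    then have ne: "fset X \<noteq> {}" by auto
    have "Rs (conjugate G) = Min ((\<lambda>G'. Ls (conjugate G')) ` fset X)"
      using Options by (simp add: Rs.simps[of "conjugate G"] conjugate_sides image_image)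
    also have "\<dots> = Min (uminus ` Rs ` fset X)"
      using IH Options by (simp add: image_image cong: image_cong)
    also have "\<dots> = - Max (Rs ` fset X)"
      using ne by (simp add: minus_Max_eq_Min)
    finally show ?thesis using Options by (simp add: Ls.simps[of G])
  qed (simp add: Rs.simps[of "conjugate G"] Ls.simps[of G] conjugate_sides)
  ultimately show ?case by blast
qed

lemma scoring_game_gsum:
  assumes "scoring_game G" "scoring_game H"
  shows "scoring_game (gsum G H)"
  using assms follower_gsum gsum_neq_empty unfolding scoring_game_def by metis

text \<open>Conjugating \<open>gsum G (waiting k)\<close> turns Left's passes into Right's, and
  negating the finite set of stops turns its maximum into a minimum.\<close>

lemma upper_eq_lower_conjugate:
  assumes "scoring_game G"
  shows "Rs_upper G = - Ls_lower (conjugate G)" "Ls_upper G = - Rs_lower (conjugate G)"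
proof -
  have "Ls_pass (conjugate G) k = - Rs (gsum G (waiting k))"
    and "Rs_pass (conjugate G) k = - Ls (gsum G (waiting k))" for k
    using stops_conjugate[OF scoring_game_gsum[OF assms scoring_game_waiting(1)[of k]]]
    by (simp_all add: conjugate_gsum)
  then have "Ls_lower (conjugate G) = Min (uminus ` range (\<lambda>k. Rs (gsum G (waiting k))))"
    "Rs_lower (conjugate G) = Min (uminus ` range (\<lambda>k. Ls (gsum G (waiting k))))"
    unfolding Ls_lower_def Rs_lower_def by (simp_all add: image_image)
  then show "Rs_upper G = - Ls_lower (conjugate G)" "Ls_upper G = - Rs_lower (conjugate G)"
    using minus_Max_eq_Min[OF finite_pass_allowed_stops(3)[OF assms]]
      minus_Max_eq_Min[OF finite_pass_allowed_stops(2)[OF assms]]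
    unfolding Rs_upper_def Ls_upper_def by force+
qed

theorem theorem22:
  fixes G H :: game
  assumes "G \<in> GS" and "H \<in> GS"
  shows "Ls_lower G + Rs_lower H \<le> Ls_lower (gsum G H) \<and>
         Ls_lower (gsum G H) \<le> Ls_lower G + Ls_lower H \<and>
         Rs_upper G + Rs_upper H \<le> Rs_upper (gsum G H) \<and>
         Rs_upper (gsum G H) \<le> Rs_upper G + Ls_upper H"
  \<comment> \<open>For the conjugates the order is reversed: the upper bound on
    \<open>Ls_lower\<close> gives the lower bound on \<open>Rs_upper\<close>, and
    conversely.\<close>
  using gsum_lower_ge[OF assms] gsum_lower_le[OF assms]
    gsum_lower_ge[OF assms[THEN GS_conjugate]] gsum_lower_le[OF assms[THEN GS_conjugate]]
    assms[THEN GS_scoring] GS_gsum[OF assms, THEN GS_scoring]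
  by (simp add: upper_eq_lower_conjugate conjugate_gsum)

end
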